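(* Let $\mathcal{A}$ be a sign pattern. If $\mathcal{A}$ requires distinct eigenvalues, then $\mathcal{A}$ requires the nSMP.
   Context: A real $n\times n$ matrix $A$ has the non-symmetric strong multiplicity property (nSMP) if the only real $n\times n$ matrix $X$ satisfying all of (1) $A\circ X=O$ (entrywise product), (2) $AX^T-X^TA=O$, and (3) $\mathrm{tr}(X^TA^k)=0$ for all $0\le k<n$, is $X=O$ (the zero matrix). A sign pattern is an $n\times n$ matrix $\mathcal{A}$ with entries in $\{+,-,0\}$; $Q(\mathcal{A})$ is the set of real $n\times n$ matrices $A$ with $A_{ij}>0$ if $\mathcal{A}_{ij}=+$, $A_{ij}<0$ if $\mathcal{A}_{ij}=-$, and $A_{ij}=0$ if $\mathcal{A}_{ij}=0$. The pattern $\mathcal{A}$ requires a property if every $A\in Q(\mathcal{A})$ has the property. A real $n\times n$ matrix has distinct eigenvalues if it has $n$ distinct (complex) eigenvalues. *)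

theory Defs
  imports "Jordan_Normal_Form.Spectral_Radius"
begin

definition trace_mat :: "'a :: comm_monoid_add mat \<Rightarrow> 'a" where
  "trace_mat A = (\<Sum>i<dim_row A. A $$ (i, i))"

definition hadamard_mat :: "'a :: times mat \<Rightarrow> 'a mat \<Rightarrow> 'a mat" (infixl \<open>\<circ>\<^sub>m\<close> 70) where
  "A \<circ>\<^sub>m B = mat (dim_row A) (dim_col A) (\<lambda>(i, j). A $$ (i, j) * B $$ (i, j))"

text \<open>The non-symmetric strong multiplicity property.  The order of the matrix is
  \<open>dim_row A\<close>; the definition is meant for square \<open>A\<close> only.\<close>

definition nSMP :: "real mat \<Rightarrow> bool" where
  "nSMP A \<longleftrightarrow> (let n = dim_row A in
     \<forall>X \<in> carrier_mat n n.
       A \<circ>\<^sub>m X = 0\<^sub>m n n \<and>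
       A * transpose_mat X - transpose_mat X * A = 0\<^sub>m n n \<and>
       (\<forall>k<n. trace_mat (transpose_mat X * A ^\<^sub>m k) = 0)
       \<longrightarrow> X = 0\<^sub>m n n)"

text \<open>For square \<open>A\<close>; the eigenvalues are the complex ones.\<close>

definition distinct_eigenvalues :: "real mat \<Rightarrow> bool" where
  "distinct_eigenvalues A \<longleftrightarrow> card (spectrum (map_mat complex_of_real A)) = dim_row A"

datatype sign = Plus | Minus | Zero

fun has_sign :: "real \<Rightarrow> sign \<Rightarrow> bool" where
  "has_sign x Plus \<longleftrightarrow> x > 0"
| "has_sign x Minus \<longleftrightarrow> x < 0"
| "has_sign x Zero \<longleftrightarrow> x = 0"

text \<open>The set \<open>Q(S)\<close> of real matrices with sign pattern \<open>S\<close>.\<close>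

definition qual_class :: "sign mat \<Rightarrow> real mat set" where
  "qual_class S = {A \<in> carrier_mat (dim_row S) (dim_col S).
     \<forall>i < dim_row S. \<forall>j < dim_col S. has_sign (A $$ (i, j)) (S $$ (i, j))}"

definition pattern_requires :: "sign mat \<Rightarrow> (real mat \<Rightarrow> bool) \<Rightarrow> bool" where
  "pattern_requires S P \<longleftrightarrow> (\<forall>A \<in> qual_class S. P A)"

end

theory Submission
  imports Defs
begin

text \<open>A matrix \<open>A\<close> with distinct eigenvalues \<open>\<lambda>\<^sub>i\<close> is diagonalizable over the complex numbers, and in
  an eigenbasis every matrix commuting with \<open>A\<close>, in particular \<open>X\<^sup>T\<close>, is diagonal, say with
  entries \<open>d\<^sub>i\<close>.  The trace conditions then read \<open>\<Sum> d\<^sub>i \<lambda>\<^sub>i\<^sup>k = 0\<close> for \<open>k < n\<close>, and since the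
  Vandermonde matrix of the \<open>\<lambda>\<^sub>i\<close> is invertible, \<open>d = 0\<close>.  The implication thus holds matrix by matrix.\<close>

text \<open>Linear combinations of the power sums give
  \<open>(\<Sum>i<n. d i * poly p (l i)) = 0\<close> for every polynomial \<open>p\<close> of degree
  below \<open>n\<close>; one that vanishes at all nodes except \<open>l j\<close> isolates
  \<open>d j\<close>.\<close>

lemma weighted_power_sums_eq_0:
  fixes l d :: "nat \<Rightarrow> 'a :: field"
  assumes inj: "inj_on l {..<n}"
    and sums: "\<And>k. k < n \<Longrightarrow> (\<Sum>i<n. d i * l i ^ k) = 0"
    and j: "j < n"
  shows "d j = 0"
proof -
  \<comment> \<open>up to a scalar, the Lagrange polynomial of the node \<open>l j\<close>\<close>
  define p where "p = (\<Prod>i\<in>{..<n} - {j}. [:- l i, 1:])"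
  have "degree p = n - 1"
    unfolding p_def using j by (subst degree_prod_eq_sum_degree) auto
  then have deg: "degree p < n" using j by simp
  have root: "poly p (l i) = 0" if "i < n" "i \<noteq> j" for i
    using that by (auto simp: p_def poly_prod)
  have nonroot: "poly p (l j) \<noteq> 0"
    using inj j by (auto simp: p_def poly_prod inj_on_def)
  have "(\<Sum>i<n. d i * poly p (l i)) = (\<Sum>i<n. \<Sum>k\<le>degree p. coeff p k * (d i * l i ^ k))"
    by (simp add: poly_altdef sum_distrib_left mult_ac)
  also have "\<dots> = (\<Sum>k\<le>degree p. coeff p k * (\<Sum>i<n. d i * l i ^ k))"
    by (subst sum.swap) (simp add: sum_distrib_left)
  \<comment> \<open>Every \<open>k\<close> up to \<open>degree p\<close> is below \<open>n\<close>,
    so each inner sum vanishes by \<open>sums\<close>.\<close>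
  also have "\<dots> = 0"
    using deg by (intro sum.neutral) (auto simp: sums)
  finally have "(\<Sum>i<n. d i * poly p (l i)) = 0" .
  moreover have "(\<Sum>i<n. d i * poly p (l i)) = (\<Sum>i\<in>{j}. d i * poly p (l i))"
    using j by (intro sum.mono_neutral_right) (auto simp: root)
  ultimately show ?thesis using nonroot by simp
qed

lemma mat_diag_pow: "mat_diag n l ^\<^sub>m k = mat_diag n (\<lambda>i. l i ^ k)"
proof (induction k)
  case 0
  then show ?case by (simp add: mat_diag_def)
next
  case (Suc k)
  then show ?case by (simp add: power_commutes)
qed

text \<open>Eigenvectors form the columns of the change of basis; it is invertible because
  eigenvectors for distinct eigenvalues are linearly independent, which is again the power sum
  lemma.\<close>

lemma similar_mat_diag_distinct_eigenvalues:
  fixes A :: "'a :: field mat"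
  assumes A: "A \<in> carrier_mat n n"
    and inj: "inj_on l {..<n}"
    and ev: "\<And>i. i < n \<Longrightarrow> eigenvalue A (l i)"
  shows "similar_mat A (mat_diag n l)"
proof -
  have "\<forall>i. \<exists>v. i < n \<longrightarrow> eigenvector A v (l i)"
    using ev unfolding eigenvalue_def by blast
  then obtain v where v: "\<And>i. i < n \<Longrightarrow> eigenvector A (v i) (l i)"
    by metis
  define P where "P = mat n n (\<lambda>(r, i). v i $ r)"
  have P: "P \<in> carrier_mat n n" by (simp add: P_def)
  have vc: "v i \<in> carrier_vec n" "v i \<noteq> 0\<^sub>v n" if "i < n" for i
    using v[OF that] A by (auto simp: eigenvector_def)
  have col: "col P i = v i" if "i < n" for i
    using vc[OF that] that by (intro eq_vecI) (auto simp: P_def)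
  \<comment> \<open>All powers are treated at once: the family over \<open>k\<close> serves to show
    \<open>P\<close> invertible, and \<open>k = 1\<close> then gives the diagonalization.\<close>
  have AkP: "A ^\<^sub>m k * P = P * mat_diag n (\<lambda>i. l i ^ k)" (is "?L = ?R") for k
  proof (rule eq_matI)
    fix r i assume "r < dim_row ?R" "i < dim_col ?R"
    then have ri: "r < n" "i < n" using P by (auto simp: mat_diag_def)
    have "?L $$ (r, i) = (A ^\<^sub>m k *\<^sub>v v i) $ r"
      using ri A P col by simp
    also have "\<dots> = l i ^ k * v i $ r"
      using eigenvector_pow[OF A v[OF ri(2)]] ri vc(1)[OF ri(2)] by auto
    also have "\<dots> = ?R $$ (r, i)"
      using ri by (subst mat_diag_mult_right[OF P]) (simp add: P_def)
    finally show "?L $$ (r, i) = ?R $$ (r, i)" .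
  qed (use A P in \<open>auto simp: mat_diag_def\<close>)
  \<comment> \<open>If \<open>P c = 0\<close> then \<open>P D\<^sup>k c = A\<^sup>k P c = 0\<close> for all \<open>k\<close>, and each row is a power sum relation.\<close>
  have "det P \<noteq> 0"
  proof
    assume "det P = 0"
    then obtain c where c: "c \<in> carrier_vec n" "c \<noteq> 0\<^sub>v n" "P *\<^sub>v c = 0\<^sub>v n"
      using det_0_iff_vec_prod_zero_field[OF P] by blast
    have "c $ i * v i $ r = 0" if "i < n" "r < n" for i r
    proof (rule weighted_power_sums_eq_0[OF inj _ \<open>i < n\<close>])
      fix k
      have "(P * mat_diag n (\<lambda>i. l i ^ k)) *\<^sub>v c = A ^\<^sub>m k *\<^sub>v (P *\<^sub>v c)"
        using A P c by (simp add: AkP[symmetric] assoc_mult_mat_vec[of _ n n _ n])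
      also have "\<dots> = 0\<^sub>v n" using A c by auto
      finally have "((P * mat_diag n (\<lambda>i. l i ^ k)) *\<^sub>v c) $ r = 0" using that by simp
      then show "(\<Sum>i<n. c $ i * v i $ r * l i ^ k) = 0"
        unfolding mat_diag_mult_right[OF P] using that c
        by (simp add: scalar_prod_def P_def mult_ac atLeast0LessThan)
    qed
    \<comment> \<open>A nonzero coefficient \<open>c $ i\<close> forces every coordinate of the
      eigenvector \<open>v i\<close> to vanish.\<close>
    moreover obtain i where i: "i < n" "c $ i \<noteq> 0"
      using c by (metis carrier_vecD eq_vecI index_zero_vec)
    ultimately have "v i = 0\<^sub>v n" using vc(1)[OF i(1)] by (intro eq_vecI) auto
    with vc i show False by blast
  qed
  \<comment> \<open>The value \<open>()\<close> merely fills the extension slot of the record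
    \<open>ring_mat\<close>.\<close>
  from det_non_zero_imp_unit[OF P this, of "()"] obtain Q
    where Q: "Q \<in> carrier_mat n n" "P * Q = 1\<^sub>m n" "Q * P = 1\<^sub>m n"
    by (auto simp: Units_def ring_mat_def)
  have "A * P = P * mat_diag n l" using AkP[of 1] A by simp
  then have "P * mat_diag n l * Q = A * (P * Q)"
    using A P Q by (metis assoc_mult_mat)
  then have "A = P * mat_diag n l * Q" using A Q by simp
  then have "similar_mat_wit A (mat_diag n l) P Q"
    using A P Q by (intro similar_mat_witI) auto
  then show ?thesis unfolding similar_mat_def by blast
qed

lemma trace_mat_mult_commute:
  fixes A B :: "'a :: comm_semiring_0 mat"
  assumes "A \<in> carrier_mat n m" "B \<in> carrier_mat m n"
  shows "trace_mat (A * B) = trace_mat (B * A)"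
proof -
  have "trace_mat (A * B) = (\<Sum>i<n. \<Sum>j<m. A $$ (i, j) * B $$ (j, i))"
    using assms by (simp add: trace_mat_def scalar_prod_def atLeast0LessThan)
  also have "\<dots> = (\<Sum>j<m. \<Sum>i<n. B $$ (j, i) * A $$ (i, j))"
    by (subst sum.swap) (simp add: mult.commute)
  also have "\<dots> = trace_mat (B * A)"
    using assms by (simp add: trace_mat_def scalar_prod_def atLeast0LessThan)
  finally show ?thesis .
qed

text \<open>Stated over any field containing all the eigenvalues, so that it applies to the
  complexification of a real matrix, with \<open>Y\<close> in the role of the transpose of
  \<open>X\<close>.\<close>

lemma commuting_traces_zero_imp_zero:
  fixes A Y :: "'a :: field mat"
  assumes A: "A \<in> carrier_mat n n" and Y: "Y \<in> carrier_mat n n"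
    and inj: "inj_on l {..<n}"
    and ev: "\<And>i. i < n \<Longrightarrow> eigenvalue A (l i)"
    and comm: "A * Y = Y * A"
    and tr: "\<And>k. k < n \<Longrightarrow> trace_mat (Y * A ^\<^sub>m k) = 0"
  shows "Y = 0\<^sub>m n n"
proof -
  define D where "D = mat_diag n l"
  obtain P Q where wit: "similar_mat_wit A D P Q"
    using similar_mat_diag_distinct_eigenvalues[OF A inj ev]
    unfolding similar_mat_def D_def by blast
  note PQ = similar_mat_witD2(1,2)[OF A wit] and A_eq = similar_mat_witD2(3)[OF A wit]
  note D = similar_mat_witD2(5)[OF A wit] and P = similar_mat_witD2(6)[OF A wit]
    and Q = similar_mat_witD2(7)[OF A wit]
  note assoc = assoc_mult_mat[of _ n n _ n _ n]
  \<comment> \<open>Rewriting with \<open>assoc\<close> nests products to the right, which hides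
    \<open>P * Q\<close> and \<open>Q * P\<close>; these forms still cancel them there.\<close>
  have cancel: "Q * (P * M) = M" "P * (Q * M) = M" if "M \<in> carrier_mat n n" for M
    using assoc[OF P Q that] assoc[OF Q P that] that PQ by simp_all
  define Z where "Z = Q * Y * P"
  have Z: "Z \<in> carrier_mat n n" using P Q Y by (simp add: Z_def)
  have YZ: "Y = P * Z * Q"
    using P Q Y PQ by (simp add: Z_def assoc cancel)
  have "D = Q * A * P" using P Q D PQ by (simp add: A_eq assoc cancel)
  then have "D * Z = Q * (A * Y) * P" "Z * D = Q * (Y * A) * P"
    using P Q A Y by (simp_all add: Z_def assoc cancel)
  then have DZ: "D * Z = Z * D" using comm by simp
  have off: "Z $$ (i, j) = 0" if "i < n" "j < n" "i \<noteq> j" for i j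
  proof -
    \<comment> \<open>Comparing entries of \<open>D * Z\<close> and \<open>Z * D\<close> leaves the
      factor \<open>l i - l j\<close>, nonzero off the diagonal.\<close>
    have "l i * Z $$ (i, j) = Z $$ (i, j) * l j"
      using arg_cong[OF DZ, of "\<lambda>M. M $$ (i, j)"] that
      by (simp add: D_def mat_diag_mult_left[OF Z] mat_diag_mult_right[OF Z])
    moreover have "l i \<noteq> l j" using inj that by (auto simp: inj_on_def)
    ultimately show ?thesis by (simp add: mult.commute)
  qed
  have diag: "Z $$ (i, i) = 0" if "i < n" for i
  proof (rule weighted_power_sums_eq_0[OF inj _ that])
    fix k assume "k < n"
    have Dk: "D ^\<^sub>m k \<in> carrier_mat n n" using D by simp
    \<comment> \<open>Bracketed with \<open>P\<close> in front, so that cyclicity of the trace moves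
      it next to \<open>Q\<close>.\<close>
    have "Y * A ^\<^sub>m k = P * (Z * D ^\<^sub>m k * Q)"
      using P Q Z Dk by (simp add: similar_mat_wit_pow_id[OF wit] YZ assoc cancel)
    then have "trace_mat (Y * A ^\<^sub>m k) = trace_mat (Z * D ^\<^sub>m k * Q * P)"
      using P Q Z Dk by (simp add: trace_mat_mult_commute[of P n n])
    also have "Z * D ^\<^sub>m k * Q * P = Z * D ^\<^sub>m k"
      using P Q Z Dk PQ by (simp add: assoc right_mult_one_mat[OF Dk])
    also have "trace_mat (Z * D ^\<^sub>m k) = (\<Sum>i<n. Z $$ (i, i) * l i ^ k)"
      using Z by (simp add: D_def mat_diag_pow mat_diag_mult_right[OF Z] trace_mat_def)
    finally show "(\<Sum>i<n. Z $$ (i, i) * l i ^ k) = 0"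
      using tr[OF \<open>k < n\<close>] by simp
  qed
  have "Z $$ (i, j) = 0" if "i < n" "j < n" for i j
    using diag off that by (cases "i = j") auto
  then have "Z = 0\<^sub>m n n" using Z by (intro eq_matI) auto
  then show ?thesis using P Q by (simp add: YZ)
qed

lemma trace_mat_hom:
  assumes "A \<in> carrier_mat n n"
  shows "trace_mat (map_mat complex_of_real A) = complex_of_real (trace_mat A)"
  using assms by (simp add: trace_mat_def)

text \<open>The embedding of the reals into the complex numbers is an injective ring homomorphism:
  it carries the commutation and trace conditions over and reflects the vanishing of the
  matrix.\<close>

lemma distinct_eigenvalues_imp_nSMP:
  assumes A: "A \<in> carrier_mat n n" and dist: "distinct_eigenvalues A"
  shows "nSMP A"
proof -
  let ?c = "map_mat complex_of_real"
  have cA: "?c A \<in> carrier_mat n n" using A by simp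
  have "finite (spectrum (?c A))" "card (spectrum (?c A)) = n"
    using card_finite_spectrum[OF cA] dist A by (auto simp: distinct_eigenvalues_def)
  then obtain l where l: "bij_betw l {..<n} (spectrum (?c A))"
    using ex_bij_betw_nat_finite atLeast0LessThan by metis
  then have inj: "inj_on l {..<n}" and ev: "\<And>i. i < n \<Longrightarrow> eigenvalue (?c A) (l i)"
    by (auto simp: bij_betw_def spectrum_def)
  have "X = 0\<^sub>m n n"
    if X: "X \<in> carrier_mat n n"
      and comm: "A * transpose_mat X - transpose_mat X * A = 0\<^sub>m n n"
      and tr: "\<forall>k<n. trace_mat (transpose_mat X * A ^\<^sub>m k) = 0" for X
  proof -
    let ?Y = "transpose_mat X"
    have Y: "?Y \<in> carrier_mat n n" using X by simp
    have "A * ?Y = ?Y * A"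
    proof (rule eq_matI)
      fix i j assume "i < dim_row (?Y * A)" "j < dim_col (?Y * A)"
      then show "(A * ?Y) $$ (i, j) = (?Y * A) $$ (i, j)"
        using A Y arg_cong[OF comm, of "\<lambda>M. M $$ (i, j)"] by simp
    qed (use A X in auto)
    then have "?c A * ?c ?Y = ?c ?Y * ?c A"
      using A Y by (metis of_real_hom.mat_hom_mult)
    moreover have "trace_mat (?c ?Y * ?c A ^\<^sub>m k) = 0" if "k < n" for k
    proof -
      have "?c ?Y * ?c A ^\<^sub>m k = ?c (?Y * A ^\<^sub>m k)"
        using A Y by (simp add: of_real_hom.mat_hom_pow of_real_hom.mat_hom_mult[of _ n n _ n])
      then show ?thesis using tr that A Y by (simp add: trace_mat_hom[of _ n])
    qed
    ultimately have "?c ?Y = 0\<^sub>m n n"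
      using commuting_traces_zero_imp_zero[OF cA _ inj ev] Y by auto
    then have "?Y = 0\<^sub>m n n"
      by (intro of_real_hom.mat_hom_inj[where 'a = complex]) auto
    then show ?thesis using X by (metis transpose_transpose zero_transpose_mat)
  qed
  then show ?thesis using A unfolding nSMP_def by auto
qed

theorem theorem4p4:
  fixes S :: "sign mat" and n :: nat
  assumes "S \<in> carrier_mat n n"
    and "pattern_requires S distinct_eigenvalues"
  shows "pattern_requires S nSMP"
proof -
  have "A \<in> carrier_mat n n" if "A \<in> qual_class S" for A
    using that assms(1) by (auto simp: qual_class_def)
  then show ?thesis
    using assms(2) distinct_eigenvalues_imp_nSMP unfolding pattern_requires_def by blast
qed

end
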